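(* Let $I_1, I_2, J$ be positive integers with $J\ge 3$. If $I_1 < I_2$, $H(i,J) \le iJ+1$ for every even $i \in \{I_1, I_1+1,\dots, I_2\}$, and $H(i,J) = iJ$ for every odd $i \in \{I_1,I_1+1, \dots, I_2\}$, then $H(I,J) = IJ$ for every $I \in \{2I_1,2I_1+1, \dots, 2I_2\}$.
   Context: A Golomb ruler is a set $\{a_1,\dots,a_k\}$ of $k$ distinct non-negative integers such that all the differences $a_i-a_j$, $i\neq j$, are distinct. An $(I,J,n)$-DGR is a set of $I$ pairwise disjoint Golomb rulers, each being a $J$-element subset of $\{1,2,\dots,n\}$. For positive integers $I,J$, $H(I,J)$ is the least positive integer $n$ such that there is an $(I,J,n)$-DGR. *)

theory Defs
  imports Main
begin

text \<open>Differences are taken in the integers, since subtraction on \<^typ>\<open>nat\<close> truncates. They are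
  indexed by ordered pairs, so both signs of each difference are included.\<close>

definition golomb_ruler :: "nat set \<Rightarrow> bool" where
  "golomb_ruler A \<longleftrightarrow>
     finite A \<and>
     inj_on (\<lambda>(a, b). int a - int b) {(a, b). a \<in> A \<and> b \<in> A \<and> a \<noteq> b}"

definition is_DGR :: "nat \<Rightarrow> nat \<Rightarrow> nat \<Rightarrow> nat set set \<Rightarrow> bool" where
  "is_DGR I J n D \<longleftrightarrow>
     finite D \<and> card D = I \<and>
     (\<forall>A\<in>D. golomb_ruler A \<and> card A = J \<and> A \<subseteq> {1..n}) \<and>
     (\<forall>A\<in>D. \<forall>B\<in>D. A \<noteq> B \<longrightarrow> A \<inter> B = {})"

text \<open>Only used for positive \<open>I\<close> and \<open>J\<close>. Then the minimum is attained: translates of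
  \<open>{2 ^ j | j < J}\<close> by multiples of \<open>2 ^ J\<close> are disjoint Golomb rulers.\<close>

definition H :: "nat \<Rightarrow> nat \<Rightarrow> nat" where
  "H I J = (LEAST n. 0 < n \<and> (\<exists>D. is_DGR I J n D))"

end

theory Submission
  imports Defs
begin

text \<open>
  Cut a Golomb ruler in two and move the upper part up. If afterwards every difference across the
  cut exceeds every difference inside the two parts, the result is again a Golomb ruler.
  A family of \<open>i\<close> rulers in \<open>{1..n}\<close>, \<open>n = i * J + 1\<close>, misses one point \<open>h\<close>, and after a reflection
  \<open>2 * h \<le> n + 1\<close>. Cutting all its rulers at \<open>h\<close> gives blocks \<open>P\<^sub>1 = {1..<h}\<close> and \<open>P\<^sub>2 = {h<..n}\<close>.
  For \<open>2 * i\<close> rulers, let \<open>R\<^sub>1\<close>, \<open>R\<^sub>2\<close> be the blocks of the reflected family and use the order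
  \<open>P\<^sub>1 R\<^sub>1 P\<^sub>2 R\<^sub>2\<close>. For \<open>k + e\<close> rulers, \<open>k\<close> odd, \<open>e\<close> even, \<open>\<bar>k - e\<bar> = 1\<close>, cut the family of size \<open>e\<close>
  and let the family of size \<open>k\<close>, which misses no point, fill the block \<open>Q\<close>.
  The order \<open>P\<^sub>1 Q P\<^sub>2\<close> works unless \<open>k = e - 1\<close> and \<open>h < J\<close>. In that case leave
  \<open>P\<^sub>1\<close>, \<open>P\<^sub>2\<close> in place, move the first point of \<open>Q\<close> into the hole \<open>h\<close>, and put the rest of \<open>Q\<close>
  after \<open>P\<^sub>2\<close>.
\<close>

section \<open>Golomb rulers under translation and reflection\<close>

text \<open>Negating a difference swaps its pair, so positive differences suffice. The equation is
  additive to avoid truncated subtraction, and \<open>b = d\<close> follows from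
  \<open>a = c\<close>.\<close>

lemma golomb_ruler_iff:
  "golomb_ruler A \<longleftrightarrow>
     finite A \<and> (\<forall>a\<in>A. \<forall>b\<in>A. \<forall>c\<in>A. \<forall>d\<in>A. a < b \<longrightarrow> c < d \<longrightarrow> b + c = d + a \<longrightarrow> a = c)"
  (is "_ \<longleftrightarrow> _ \<and> ?P")
proof -
  let ?S = "{(a, b). a \<in> A \<and> b \<in> A \<and> a \<noteq> b}"
  have "inj_on (\<lambda>(a, b). int a - int b) ?S \<longleftrightarrow> ?P"
  proof
    assume inj: "inj_on (\<lambda>(a, b). int a - int b) ?S"
    show ?P
    proof (intro ballI impI)
      fix a b c d
      assume "a \<in> A" "b \<in> A" "c \<in> A" "d \<in> A" "a < b" "c < d" "b + c = d + a"
      then show "a = c"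
        using inj_onD[OF inj, of "(b, a)" "(d, c)"] by auto
    qed
  next
    assume P: ?P
    show "inj_on (\<lambda>(a, b). int a - int b) ?S"
    proof (rule inj_onI)
      fix x y
      assume x: "x \<in> ?S" and y: "y \<in> ?S"
        and eq: "(\<lambda>(a, b). int a - int b) x = (\<lambda>(a, b). int a - int b) y"
      obtain a b c d where xy: "x = (a, b)" "y = (c, d)"
        by fastforce
      have mem: "a \<in> A" "b \<in> A" "c \<in> A" "d \<in> A" "a \<noteq> b" "c \<noteq> d"
        using x y xy by auto
      have sum: "a + d = c + b"
        using eq xy by simp
      show "x = y"
      proof (cases "a < b")
        case True
        then have "c < d" using sum by linarith
        then have "a = c" using P mem True sum by (metis add.commute)
        then show ?thesis using sum xy by simp
      next
        case False
        then have "b < a" "d < c" using sum mem by linarith+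
        then have "b = d" using P mem sum by blast
        then show ?thesis using sum xy by simp
      qed
    qed
  qed
  then show ?thesis
    by (simp add: golomb_ruler_def)
qed

lemma golomb_rulerD:
  assumes "golomb_ruler A" "a \<in> A" "b \<in> A" "c \<in> A" "d \<in> A" "a < b" "c < d" "b + c = d + a"
  shows "a = c"
  using assms unfolding golomb_ruler_iff by blast

lemma golomb_ruler_shift:
  assumes "golomb_ruler A"
  shows "golomb_ruler ((\<lambda>x. x + p) ` A)"
  using assms unfolding golomb_ruler_iff by simp

lemma golomb_ruler_reflect:
  assumes A: "golomb_ruler A" "A \<subseteq> {1..n}"
  shows "golomb_ruler ((\<lambda>x. n + 1 - x) ` A)"
  unfolding golomb_ruler_iff
proof (intro conjI ballI impI)
  show "finite ((\<lambda>x. n + 1 - x) ` A)"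
    using A by (simp add: golomb_ruler_def)
  fix a' b' c' d'
  assume "a' \<in> (\<lambda>x. n + 1 - x) ` A" "b' \<in> (\<lambda>x. n + 1 - x) ` A"
    "c' \<in> (\<lambda>x. n + 1 - x) ` A" "d' \<in> (\<lambda>x. n + 1 - x) ` A"
  then obtain a b c d where *: "a \<in> A" "b \<in> A" "c \<in> A" "d \<in> A"
    "a' = n + 1 - a" "b' = n + 1 - b" "c' = n + 1 - c" "d' = n + 1 - d" by blast
  have bounds: "a \<le> n" "b \<le> n" "c \<le> n" "d \<le> n" using * A by auto
  assume "a' < b'" "c' < d'" "b' + c' = d' + a'"
  then have "b < a" "d < c" "a + d = c + b" using * bounds by linarith+
  then show "a' = c'" using golomb_rulerD[OF A(1), of b a d c] * by simp
qed

section \<open>Cutting a ruler and moving its two parts\<close>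

definition split_shift :: "nat \<Rightarrow> nat \<Rightarrow> nat \<Rightarrow> nat \<Rightarrow> nat" where
  "split_shift t p q x = (if x \<le> t then x + p else x + q)"

lemma inj_split_shift: "p \<le> q \<Longrightarrow> inj (split_shift t p q)"
  by (auto simp: inj_def split_shift_def)

text \<open>The last two hypotheses say that the smallest difference across the cut, \<open>(s + q) - (t + p)\<close>,
  exceeds the largest ones inside the parts, \<open>t - 1\<close> and \<open>n - s\<close>.\<close>

lemma golomb_ruler_split_shift:
  assumes A: "golomb_ruler A" "A \<subseteq> {1..t} \<union> {s..n}"
    and "t < s" "p \<le> q" "2 * t + p \<le> q + s" "n + t + p < q + 2 * s"
  shows "golomb_ruler (split_shift t p q ` A)"
  unfolding golomb_ruler_iff
proof (intro conjI ballI impI)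
  show "finite (split_shift t p q ` A)"
    using A by (simp add: golomb_ruler_def)
  fix a' b' c' d'
  assume "a' \<in> split_shift t p q ` A" "b' \<in> split_shift t p q ` A"
    "c' \<in> split_shift t p q ` A" "d' \<in> split_shift t p q ` A"
  then obtain a b c d where *: "a \<in> A" "b \<in> A" "c \<in> A" "d \<in> A"
    "a' = split_shift t p q a" "b' = split_shift t p q b"
    "c' = split_shift t p q c" "d' = split_shift t p q d" by blast
  have step: "x < y \<and>
      (f y + x = f x + y \<and> f y + (t + p) < f x + (s + q) \<or>
       f y + x + p = f x + y + q \<and> f x + (s + q) \<le> f y + (t + p))"
    if "x \<in> A" "y \<in> A" "f x < f y" and f: "f = split_shift t p q" for x y f
  proof -
    have "x \<in> {1..t} \<union> {s..n}" "y \<in> {1..t} \<union> {s..n}" using that A(2) by blast+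
    then have "1 \<le> x" "x \<le> t \<or> s \<le> x \<and> x \<le> n" "1 \<le> y" "y \<le> t \<or> s \<le> y \<and> y \<le> n"
      using \<open>t < s\<close> by auto
    then show ?thesis
      using \<open>f x < f y\<close> assms(3-) unfolding f split_shift_def
      by (cases "x \<le> t"; cases "y \<le> t"; simp)
  qed
  assume "a' < b'" "c' < d'" and sum: "b' + c' = d' + a'"
  then have "a < b" "c < d" "b + c = d + a"
    using step[OF *(1,2) _ refl] step[OF *(3,4) _ refl] unfolding *(5-8) by linarith+
  then show "a' = c'" using golomb_rulerD[OF A(1), of a b c d] * by simp
qed

section \<open>Families of disjoint rulers\<close>

lemma is_DGR_image:
  assumes D: "is_DGR I J n D"
    and inj: "inj_on f (\<Union>D)"
    and gol: "\<And>A. A \<in> D \<Longrightarrow> golomb_ruler (f ` A)"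
    and sub: "f ` \<Union>D \<subseteq> {1..m}"
  shows "is_DGR I J m ((`) f ` D)"
  unfolding is_DGR_def
proof (intro conjI ballI impI)
  show "finite ((`) f ` D)" using D by (simp add: is_DGR_def)
  have "inj_on ((`) f) D" by (rule inj_on_image[OF inj])
  then show "card ((`) f ` D) = I" using D by (simp add: is_DGR_def card_image)
next
  fix B assume "B \<in> (`) f ` D"
  then obtain A where A: "A \<in> D" "B = f ` A" by blast
  show "golomb_ruler B" using A gol by simp
  have "inj_on f A" by (rule inj_on_subset[OF inj]) (use A in blast)
  then show "card B = J" using A D by (simp add: is_DGR_def card_image)
  show "B \<subseteq> {1..m}" using A sub by blast
next
  fix B C assume "B \<in> (`) f ` D" "C \<in> (`) f ` D" "B \<noteq> C"
  then obtain A A' where A: "A \<in> D" "B = f ` A" "A' \<in> D" "C = f ` A'" "A \<noteq> A'" by blast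
  then have "A \<inter> A' = {}" using D by (simp add: is_DGR_def)
  then show "B \<inter> C = {}" using A inj by (auto dest!: inj_onD)
qed

lemma is_DGR_Un:
  assumes D: "is_DGR I J n D" and E: "is_DGR K J n E" and "0 < J"
    and disj: "\<Union>D \<inter> \<Union>E = {}"
  shows "is_DGR (I + K) J n (D \<union> E)"
proof -
  \<comment> \<open>Disjoint unions still allow the empty ruler in both families;
    \<open>0 < J\<close> excludes it.\<close>
  have "{} \<notin> D" using D \<open>0 < J\<close> by (auto simp: is_DGR_def)
  have DE: "A \<inter> B = {}" if "A \<in> D" "B \<in> E" for A B
    using disj that by blast
  then have "D \<inter> E = {}" using \<open>{} \<notin> D\<close> by (metis Int_absorb disjoint_iff)
  then have "card (D \<union> E) = I + K" using D E by (simp add: is_DGR_def card_Un_disjoint)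
  moreover have "A \<inter> B = {}" if "A \<in> D \<union> E" "B \<in> D \<union> E" "A \<noteq> B" for A B
  proof -
    have "A \<inter> B = {}" if "A \<in> D" "B \<in> D" using D that \<open>A \<noteq> B\<close> by (simp add: is_DGR_def)
    moreover have "A \<inter> B = {}" if "A \<in> E" "B \<in> E" using E that \<open>A \<noteq> B\<close> by (simp add: is_DGR_def)
    moreover have "A \<inter> B = {}" if "A \<in> E" "B \<in> D" using DE[OF that(2,1)] by (simp add: Int_commute)
    ultimately show ?thesis using that(1,2) DE[of A B] by (elim UnE) simp_all
  qed
  moreover have "golomb_ruler A \<and> card A = J \<and> A \<subseteq> {1..n}" if "A \<in> D \<union> E" for A
    using that D E by (elim UnE) (simp_all add: is_DGR_def)
  moreover have "finite (D \<union> E)" using D E by (simp add: is_DGR_def)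
  ultimately show ?thesis unfolding is_DGR_def by simp
qed

lemma is_DGR_Union:
  assumes "is_DGR I J n D"
  shows "\<Union>D \<subseteq> {1..n}" and "card (\<Union>D) = I * J"
proof -
  show "\<Union>D \<subseteq> {1..n}" using assms unfolding is_DGR_def by blast
  have "card (\<Union>D) = (\<Sum>A\<in>D. card A)"
    using assms unfolding is_DGR_def golomb_ruler_def
    by (intro card_Union_disjoint) (auto simp: pairwise_def disjnt_def)
  also have "\<dots> = I * J" using assms by (simp add: is_DGR_def)
  finally show "card (\<Union>D) = I * J" .
qed

lemma is_DGR_mono: "is_DGR I J n D \<Longrightarrow> n \<le> m \<Longrightarrow> is_DGR I J m D"
  unfolding is_DGR_def by (metis atLeastatMost_subset_iff order_refl order_trans)

lemma is_DGR_le: "is_DGR I J n D \<Longrightarrow> I * J \<le> n"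
  using is_DGR_Union[of I J n D] card_mono[of "{1..n}" "\<Union>D"] by simp

section \<open>Existence of families and the value of \<open>H\<close>\<close>

text \<open>To a ruler in \<open>{1..n}\<close> the point \<open>2 * n + 1\<close> can be added:
  each new difference exceeds \<open>n\<close>, each old one is below \<open>n\<close>.\<close>

lemma golomb_ruler_exists: "\<exists>A n. golomb_ruler A \<and> card A = J \<and> A \<subseteq> {1..n}"
proof (induction J)
  case 0
  show ?case by (rule exI[of _ "{}"]) (simp add: golomb_ruler_iff)
next
  case (Suc J)
  then obtain A n where A: "golomb_ruler A" "card A = J" "A \<subseteq> {1..n}" by blast
  have bound: "x \<le> n" if "x \<in> A" for x using A that by auto
  have "golomb_ruler (insert (2 * n + 1) A)"
    unfolding golomb_ruler_iff
  proof (intro conjI ballI impI)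
    show "finite (insert (2 * n + 1) A)" using A by (simp add: golomb_ruler_def)
    fix a b c d
    assume mem: "a \<in> insert (2 * n + 1) A" "b \<in> insert (2 * n + 1) A"
      "c \<in> insert (2 * n + 1) A" "d \<in> insert (2 * n + 1) A"
      and *: "a < b" "c < d" "b + c = d + a"
    have ac: "a \<in> A" "c \<in> A" using mem * bound by force+
    show "a = c"
    proof (cases "b = d")
      case False
      then have "b \<in> A \<and> d \<in> A" using mem ac * bound[of a] bound[of b] bound[of c] bound[of d]
        by auto
      then show ?thesis using golomb_rulerD[OF A(1), of a b c d] ac * by simp
    qed (use * in simp)
  qed
  moreover have "2 * n + 1 \<notin> A" using bound by force
  then have "card (insert (2 * n + 1) A) = Suc J"
    using A by (simp add: golomb_ruler_def)
  moreover have "insert (2 * n + 1) A \<subseteq> {1..2 * n + 1}" using A by auto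
  ultimately show ?case by blast
qed

lemma is_DGR_exists:
  assumes "0 < J"
  shows "\<exists>n D. is_DGR I J n D"
proof (induction I)
  case 0
  show ?case by (rule exI[of _ 0], rule exI[of _ "{}"]) (simp add: is_DGR_def)
next
  case (Suc I)
  then obtain n D where D: "is_DGR I J n D" by blast
  obtain A m where A: "golomb_ruler A" "card A = J" "A \<subseteq> {1..m}"
    using golomb_ruler_exists by blast
  let ?A = "(\<lambda>x. x + n) ` A"
  have "is_DGR 1 J (n + m) {?A}"
    using A by (auto simp: is_DGR_def golomb_ruler_shift card_image)
  moreover have "\<Union>D \<inter> \<Union>{?A} = {}"
    using is_DGR_Union(1)[OF D] A(3) by fastforce
  ultimately have "is_DGR (I + 1) J (n + m) (D \<union> {?A})"
    by (intro is_DGR_Un[OF is_DGR_mono[OF D] _ assms]) simp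
  then show ?case by auto
qed

text \<open>A bound on a \<open>LEAST\<close> yields a witness only once some \<open>n\<close>
  qualifies; \<open>is_DGR_exists\<close> supplies one.\<close>

lemma is_DGR_if_H_le:
  assumes "0 < J" "H I J \<le> n"
  shows "\<exists>D. is_DGR I J n D"
proof -
  obtain m D where "is_DGR I J m D" using is_DGR_exists[OF assms(1), of I] by blast
  \<comment> \<open>\<open>Suc\<close> secures the positivity demanded in \<open>H\<close>.\<close>
  then have "is_DGR I J (Suc m) D" by (rule is_DGR_mono) simp
  then have "0 < Suc m \<and> (\<exists>D. is_DGR I J (Suc m) D)" by blast
  then have "0 < H I J \<and> (\<exists>D. is_DGR I J (H I J) D)" unfolding H_def by (rule LeastI)
  then show ?thesis using is_DGR_mono assms(2) by blast
qed

text \<open>Disjoint rulers occupy \<open>I * J\<close> points, so no smaller \<open>n\<close> is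
  possible.\<close>

lemma H_eqI:
  assumes "is_DGR I J (I * J) D" "0 < I" "0 < J"
  shows "H I J = I * J"
  unfolding H_def
proof (rule Least_equality)
  show "0 < I * J \<and> (\<exists>D. is_DGR I J (I * J) D)" using assms by fastforce
  show "I * J \<le> m" if "0 < m \<and> (\<exists>D. is_DGR I J m D)" for m
    using that is_DGR_le by blast
qed

section \<open>Reflecting, cutting and shifting families\<close>

lemma is_DGR_reflect:
  assumes D: "is_DGR I J n D"
  shows "is_DGR I J n ((`) ((`) (\<lambda>x. n + 1 - x)) D)"
proof (rule is_DGR_image[OF D])
  have sub: "\<Union>D \<subseteq> {1..n}" by (rule is_DGR_Union[OF D])
  then show "inj_on (\<lambda>x. n + 1 - x) (\<Union>D)"
    by (fastforce intro!: inj_onI)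
  show "(\<lambda>x. n + 1 - x) ` \<Union>D \<subseteq> {1..n}"
    using sub by fastforce
  show "golomb_ruler ((\<lambda>x. n + 1 - x) ` A)" if "A \<in> D" for A
    using D that by (intro golomb_ruler_reflect) (auto simp: is_DGR_def)
qed

lemma reflect_avoids:
  assumes "\<Union>D \<subseteq> {1..n} - {h}" "1 \<le> h" "h \<le> n"
  shows "\<Union>((`) ((`) (\<lambda>x. n + 1 - x)) D) \<subseteq> {1..n} - {n + 1 - h :: nat}"
proof
  fix y assume "y \<in> \<Union>((`) ((`) (\<lambda>x. n + 1 - x)) D)"
  then obtain x where "x \<in> \<Union>D" "y = n + 1 - x" by blast
  moreover from this have "1 \<le> x" "x \<le> n" "x \<noteq> h" using assms by auto
  ultimately show "y \<in> {1..n} - {n + 1 - h}" using assms by auto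
qed

lemma is_DGR_hole:
  assumes D: "is_DGR I J n D" and n: "n = I * J + 1"
  obtains D h where "is_DGR I J n D" "\<Union>D \<subseteq> {1..n} - {h}" "1 \<le> h" "2 * h \<le> n + 1"
proof -
  have "\<Union>D \<noteq> {1..n}"
    using is_DGR_Union(2)[OF D] n by auto
  then obtain h where "h \<in> {1..n}" "h \<notin> \<Union>D"
    using is_DGR_Union(1)[OF D] by blast
  then have h: "1 \<le> h" "h \<le> n" "\<Union>D \<subseteq> {1..n} - {h}"
    using is_DGR_Union(1)[OF D] by auto
  show thesis
  proof (cases "2 * h \<le> n + 1")
    case True
    then show thesis using that D h by blast
  next
    case False
    \<comment> \<open>A hole in the upper half is reflected into the lower half.\<close>
    then have "1 \<le> n + 1 - h" "2 * (n + 1 - h) \<le> n + 1" using h by linarith+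
    then show thesis
      using that[OF is_DGR_reflect[OF D] reflect_avoids[OF h(3,1,2)]] by blast
  qed
qed

lemma is_DGR_split_shift:
  assumes D: "is_DGR I J n D" and sub: "\<Union>D \<subseteq> {1..t} \<union> {s..n}"
    and le: "t < s" "p \<le> q" "2 * t + p \<le> q + s" "n + t + p < q + 2 * s" "t + p \<le> m" "n + q \<le> m"
  shows "is_DGR I J m ((`) ((`) (split_shift t p q)) D)"
proof (rule is_DGR_image[OF D])
  show "inj_on (split_shift t p q) (\<Union>D)"
    using inj_split_shift[OF le(2)] inj_on_subset by blast
  show "golomb_ruler (split_shift t p q ` A)" if "A \<in> D" for A
    using D that sub le by (intro golomb_ruler_split_shift[of A t s n]) (auto simp: is_DGR_def)
  show "split_shift t p q ` \<Union>D \<subseteq> {1..m}"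
  proof
    fix y assume "y \<in> split_shift t p q ` \<Union>D"
    then obtain x where x: "x \<in> \<Union>D" "y = split_shift t p q x" by blast
    then have "1 \<le> x" "x \<le> t \<or> s \<le> x \<and> x \<le> n" using sub is_DGR_Union(1)[OF D] by auto
    then show "y \<in> {1..m}" using le x(2) by (auto simp: split_shift_def)
  qed
qed

lemma is_DGR_shift:
  assumes D: "is_DGR I J n D" and "n + p \<le> m"
  shows "is_DGR I J m ((`) ((`) (\<lambda>x. x + p)) D)"
proof (rule is_DGR_image[OF D])
  show "golomb_ruler ((\<lambda>x. x + p) ` A)" if "A \<in> D" for A
    using D that by (intro golomb_ruler_shift) (auto simp: is_DGR_def)
  show "(\<lambda>x. x + p) ` \<Union>D \<subseteq> {1..m}"
    using is_DGR_Union(1)[OF D] assms(2) by fastforce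
qed simp

lemma minus_hole_subset: "{1..n} - {h} \<subseteq> {1..h - 1} \<union> {h + 1..n :: nat}"
  by auto

section \<open>The two constructions\<close>

lemma is_DGR_double:
  assumes D: "is_DGR i J (i * J + 1) D" and pos: "0 < i" "0 < J"
  shows "\<exists>E. is_DGR (2 * i) J (2 * i * J) E"
proof -
  define n where "n = i * J + 1"
  have n2: "2 \<le> n" and m: "2 * i * J = 2 * n - 2" using pos by (auto simp: n_def)
  obtain D h where D: "is_DGR i J n D" "\<Union>D \<subseteq> {1..n} - {h}" and h: "1 \<le> h" "2 * h \<le> n + 1"
    by (rule is_DGR_hole[OF D[folded n_def] n_def])
  let ?D' = "(`) ((`) (\<lambda>x. n + 1 - x)) D"
  have D': "is_DGR i J n ?D'" "\<Union>?D' \<subseteq> {1..n} - {n + 1 - h}"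
    by (rule is_DGR_reflect[OF D(1)], rule reflect_avoids[OF D(2)]) (use h in linarith)+
  \<comment> \<open>The blocks \<open>P\<^sub>1\<close>, \<open>R\<^sub>1\<close>,
    \<open>P\<^sub>2\<close>, \<open>R\<^sub>2\<close> have lengths \<open>h - 1\<close>,
    \<open>n - h\<close>, \<open>n - h\<close>, \<open>h - 1\<close> and start at \<open>1\<close>,
    \<open>h\<close>, \<open>n\<close>, \<open>2 * n - h\<close>. For both families the smallest
    difference across the cut is \<open>n - h + 1\<close>, while no block is longer than
    \<open>n - h\<close> because \<open>2 * h <= n + 1\<close>.\<close>
  let ?f = "split_shift (h - 1) 0 (n - h - 1)"
  let ?g = "split_shift (n + 1 - h - 1) (h - 1) (n - 2)"
  have "\<Union>D \<subseteq> {1..h - 1} \<union> {h + 1..n}" using D(2) minus_hole_subset by (rule order_trans)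
  then have E: "is_DGR i J (2 * n - 2) ((`) ((`) ?f) D)"
    using h n2 by (intro is_DGR_split_shift[OF D(1)]) auto
  have "\<Union>?D' \<subseteq> {1..n + 1 - h - 1} \<union> {n + 1 - h + 1..n}"
    using D'(2) minus_hole_subset by (rule order_trans)
  then have E': "is_DGR i J (2 * n - 2) ((`) ((`) ?g) ?D')"
    using h n2 by (intro is_DGR_split_shift[OF D'(1)]) auto
  have ne: "?f x \<noteq> ?g y" if "x \<in> \<Union>D" "y \<in> \<Union>?D'" for x y
  proof -
    have "x \<in> {1..n} - {h}" "y \<in> {1..n} - {n + 1 - h}"
      using that D(2) D'(2) by blast+
    then show ?thesis using h n2 unfolding split_shift_def
      by (cases "x < h"; cases "y < n + 1 - h"; simp; linarith)
  qed
  have "\<Union>((`) ((`) ?f) D) \<inter> \<Union>((`) ((`) ?g) ?D') = {}"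
    using ne by blast
  from is_DGR_Un[OF E E' pos(2) this, folded mult_2] show ?thesis
    unfolding m by blast
qed

lemma is_DGR_consecutive:
  assumes C: "is_DGR k J (k * J) C" and D: "is_DGR e J (e * J + 1) D"
    and pos: "0 < k" "0 < J" and ke: "e = Suc k \<or> k = Suc e"
  shows "\<exists>E. is_DGR (k + e) J ((k + e) * J) E"
proof -
  define n where "n = e * J + 1"
  define r where "r = k * J"
  have m: "(k + e) * J = n - 1 + r" by (simp add: n_def r_def algebra_simps)
  have rJ: "J \<le> r" using pos by (simp add: r_def)
  have nr: "e = Suc k \<and> n = r + J + 1 \<or> r + 1 = n + J"
    using ke by (auto simp: n_def r_def)
  obtain D h where D: "is_DGR e J n D" "\<Union>D \<subseteq> {1..n} - {h}" and h: "1 \<le> h" "2 * h \<le> n + 1"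
    by (rule is_DGR_hole[OF D[folded n_def] n_def])
  have C: "is_DGR k J r C" "\<Union>C \<subseteq> {1..r}" using C is_DGR_Union by (auto simp: r_def)
  show ?thesis
  \<comment> \<open>\<open>r < n\<close> encodes \<open>e = Suc k\<close>, since otherwise
    \<open>r = n - 1 + J\<close>.\<close>
  proof (cases "r < n \<and> h < J")
    case True
    \<comment> \<open>The point \<open>1\<close> goes to \<open>h\<close>, and \<open>{2..r}\<close>
      goes to the places from \<open>n + 1\<close> on. Differences across the cut are at least
      \<open>n + 1 - h\<close>; those inside the rest are at most \<open>r - 2\<close>, which is
      smaller as \<open>n = r + J + 1\<close> and \<open>h < J\<close>.\<close>
    let ?f = "split_shift 1 (h - 1) (n - 1)"
    have "\<Union>C \<subseteq> {1..1} \<union> {2..r}" using C(2) by (rule order_trans) auto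
    then have E: "is_DGR k J (n - 1 + r) ((`) ((`) ?f) C)"
      using h True rJ nr pos by (intro is_DGR_split_shift[OF C(1)]) auto
    have E': "is_DGR e J (n - 1 + r) D"
      using is_DGR_mono[OF D(1)] rJ pos by simp
    have ne: "?f x \<noteq> y" if "x \<in> \<Union>C" "y \<in> \<Union>D" for x y
    proof -
      have "x \<in> {1..r}" "y \<in> {1..n} - {h}" using that D(2) C(2) by blast+
      then show ?thesis using h unfolding split_shift_def
        by (cases "x \<le> 1"; simp; linarith)
    qed
    have "\<Union>((`) ((`) ?f) C) \<inter> \<Union>D = {}"
      using ne by blast
    from is_DGR_Un[OF E E' pos(2) this] show ?thesis
      unfolding m by blast
  next
    case False
    let ?f = "\<lambda>x. x + (h - 1)"
    \<comment> \<open>\<open>Q\<close> occupies \<open>{h..h + r - 1}\<close>, so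
      \<open>P\<^sub>2\<close> starts at \<open>h + r\<close> and the smallest difference across the
      cut is \<open>r + 1\<close>. It must exceed \<open>n - h - 1\<close>, the bound inside
      \<open>P\<^sub>2\<close>: clear if \<open>n <= r\<close>, and otherwise
      \<open>n = r + J + 1\<close> with \<open>J <= h\<close>.\<close>
    let ?g = "split_shift (h - 1) 0 (r - 1)"
    have hn: "h \<le> n" using h by linarith
    have E: "is_DGR k J (n - 1 + r) ((`) ((`) ?f) C)"
      using h hn by (intro is_DGR_shift[OF C(1)]) auto
    have "\<Union>D \<subseteq> {1..h - 1} \<union> {h + 1..n}" using D(2) minus_hole_subset by (rule order_trans)
    then have E': "is_DGR e J (n - 1 + r) ((`) ((`) ?g) D)"
      using h hn False rJ nr pos by (intro is_DGR_split_shift[OF D(1)]) auto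
    have ne: "?f x \<noteq> ?g y" if "x \<in> \<Union>C" "y \<in> \<Union>D" for x y
    proof -
      have "x \<in> {1..r}" "y \<in> {1..n} - {h}" using that D(2) C(2) by blast+
      then show ?thesis using h unfolding split_shift_def
        by (cases "y < h"; simp; linarith)
    qed
    have "\<Union>((`) ((`) ?f) C) \<inter> \<Union>((`) ((`) ?g) D) = {}"
      using ne by blast
    from is_DGR_Un[OF E E' pos(2) this] show ?thesis
      unfolding m by blast
  qed
qed

theorem theorem7:
  fixes I1 I2 J :: nat
  assumes "0 < I1" and "0 < I2" and "3 \<le> J"
    and "I1 < I2"
    and "\<forall>i\<in>{I1..I2}. even i \<longrightarrow> H i J \<le> i * J + 1"
    and "\<forall>i\<in>{I1..I2}. odd i \<longrightarrow> H i J = i * J"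
  shows "\<forall>I\<in>{2 * I1..2 * I2}. H I J = I * J"
proof
  fix I assume I: "I \<in> {2 * I1..2 * I2}"
  have J: "0 < J" using assms(3) by simp
  \<comment> \<open>Odd \<open>i\<close> are included by weakening the exact value, so doubling
    applies to both parities.\<close>
  have near: "\<exists>D. is_DGR i J (i * J + 1) D" if "i \<in> {I1..I2}" for i
    using that assms(5,6) by (intro is_DGR_if_H_le[OF J]) (cases "even i"; simp)
  have exact: "\<exists>D. is_DGR i J (i * J) D" if "i \<in> {I1..I2}" "odd i" for i
    using that assms(6) by (intro is_DGR_if_H_le[OF J]) simp
  have "\<exists>D. is_DGR I J (I * J) D"
  proof (cases "even I")
    case True
    then obtain i where i: "I = 2 * i" by blast
    then have "i \<in> {I1..I2}" using I by simp
    then show ?thesis using near is_DGR_double[of i J] J assms(1) i by fastforce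
  next
    case False
    then obtain i where i: "I = 2 * i + 1" by (rule oddE)
    \<comment> \<open>As \<open>I\<close> is odd, it differs from both even endpoints, so
      \<open>i\<close> and \<open>Suc i\<close> both lie in the range. The odd one gives the family
      without a hole, the even one the family to be cut.\<close>
    then have mem: "i \<in> {I1..I2}" "Suc i \<in> {I1..I2}" using I by auto
    show ?thesis
    proof (cases "odd i")
      case True
      then obtain C D where "is_DGR i J (i * J) C" "is_DGR (Suc i) J (Suc i * J + 1) D"
        using exact near mem by blast
      from is_DGR_consecutive[OF this] mem J assms(1) i show ?thesis
        by (simp add: mult_2)
    next
      case False
      then obtain C D where "is_DGR (Suc i) J (Suc i * J) C" "is_DGR i J (i * J + 1) D"
        using exact[of "Suc i"] near mem by (metis even_Suc)
      from is_DGR_consecutive[OF this] mem J assms(1) i show ?thesis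
        by (simp add: mult_2)
    qed
  qed
  moreover have "0 < I" using I assms(1) by auto
  ultimately show "H I J = I * J" using H_eqI J by blast
qed

end
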